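(* Let $1\le p<q<\infty$, let $(X,\mu)$ be a $\sigma$-finite standard measure space, let $G$ be a topological group and let $G\to\mathrm{Aut}(X,[\mu])\ltimes L_0(X,\mu,\mathbf{T})$, $g\mapsto(\sigma_g,\omega_g)$, be a continuous homomorphism. Suppose that $H^1_\sharp(G,\pi^{q,\mu},L_q(X,\mu))=0$, i.e. for every $f\in L_0(X,\mu)$ such that $\pi^{q,\mu}(g)f-f\in L_q(X,\mu)$ for all $g\in G$, there exists $h\in L_q(X,\mu)$ with $\pi^{q,\mu}(g)f-f=\pi^{q,\mu}(g)h-h$ for all $g$. Then $H^1_\sharp(G,\pi^{p,\mu},L_p(X,\mu))=0$, i.e. the same statement holds with $q$ replaced by $p$.
   Context: $\mathrm{Aut}(X,[\mu])$ is the group of nonsingular automorphisms of $(X,\mu)$ (modulo null sets), with the topology of pointwise convergence on probability measures in $[\mu]$; it acts on $L_0(X,\mu,\mathbf{T})$ by $\theta(u)=u\circ\theta^{-1}$, and the semidirect product has multiplication $(\theta,u)(\theta',u')=(\theta\theta',u\,\theta(u'))$. For $0<r<\infty$, the element $(\theta,u)$ acts on $L_0(X,\mu)$ by $\pi^{r,\mu}(\theta,u)f=u\cdot\big(\tfrac{d\theta_*\mu}{d\mu}\big)^{1/r}\,f\circ\theta^{-1}$, which restricts to a linear isometry of $L_r(X,\mu)$; composing with the homomorphism from $G$ gives $\pi^{r,\mu}:G\to$ linear maps of $L_0(X,\mu)$. $H^1(G,\pi^{r,\mu},L_r)$ is the space of continuous cocycles $c:G\to L_r$ with $c(gh)=c(g)+\pi^{r,\mu}(g)c(h)$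 modulo those of the form $g\mapsto\pi^{r,\mu}(g)f-f$ with $f\in L_r$, and $H^1_\sharp(G,\pi^{r,\mu},L_r)$ is the kernel of the natural map $H^1(G,\pi^{r,\mu},L_r(X,\mu))\to H^1(G,\pi^{r,\mu},L_0(X,\mu))$. *)

theory Defs
  imports "HOL-Probability.Probability"
begin

definition borel_iso_onto :: "'a measure \<Rightarrow> ('a \<Rightarrow> 'p::polish_space) \<Rightarrow> 'p set \<Rightarrow> bool" where
  "borel_iso_onto M f B \<longleftrightarrow> B \<in> sets borel \<and> bij_betw f (space M) B \<and>
     f \<in> measurable M borel \<and> (\<forall>A\<in>sets M. f ` A \<in> sets borel)"

definition nonsing_aut :: "'a measure \<Rightarrow> ('a \<Rightarrow> 'a) \<Rightarrow> bool" where
  "nonsing_aut M \<theta> \<longleftrightarrow> bij_betw \<theta> (space M) (space M) \<and> \<theta> \<in> measurable M M \<and>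
     inv_into (space M) \<theta> \<in> measurable M M \<and>
     (\<forall>A\<in>sets M. emeasure M (\<theta> -` A \<inter> space M) = 0 \<longleftrightarrow> emeasure M A = 0)"

definition equiv_prob :: "'a measure \<Rightarrow> 'a measure \<Rightarrow> bool" where
  "equiv_prob M \<nu> \<longleftrightarrow> prob_space \<nu> \<and> sets \<nu> = sets M \<and>
     (\<forall>A\<in>sets M. emeasure \<nu> A = 0 \<longleftrightarrow> emeasure M A = 0)"

text \<open>Continuity of g \<mapsto> sigma_g into Aut(X,[mu]): for every probability measure nu in [mu],
  g \<mapsto> (sigma_g)_* nu is continuous for the total variation norm.\<close>
definition aut_continuous :: "'a measure \<Rightarrow> ('g::topological_space \<Rightarrow> 'a \<Rightarrow> 'a) \<Rightarrow> bool" where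
  "aut_continuous M \<sigma> \<longleftrightarrow> (\<forall>\<nu>. equiv_prob M \<nu> \<longrightarrow> (\<forall>g0. \<forall>e>0. \<forall>\<^sub>F g in nhds g0.
     \<forall>A\<in>sets M. \<bar>measure (distr \<nu> M (\<sigma> g)) A - measure (distr \<nu> M (\<sigma> g0)) A\<bar> < e))"

definition L0_continuous :: "'a measure \<Rightarrow> ('g::topological_space \<Rightarrow> 'a \<Rightarrow> complex) \<Rightarrow> bool" where
  "L0_continuous M \<omega> \<longleftrightarrow> (\<forall>g0. \<forall>A\<in>sets M. emeasure M A < \<infinity> \<longrightarrow> (\<forall>e>0. \<forall>\<^sub>F g in nhds g0.
     emeasure M {x\<in>A. e \<le> norm (\<omega> g x - \<omega> g0 x)} < ennreal e))"

definition memLp :: "'a measure \<Rightarrow> real \<Rightarrow> ('a \<Rightarrow> complex) \<Rightarrow> bool" where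
  "memLp M r h \<longleftrightarrow> h \<in> borel_measurable M \<and> integrable M (\<lambda>x. norm (h x) powr r)"

definition pi_op :: "'a measure \<Rightarrow> real \<Rightarrow> ('a \<Rightarrow> 'a) \<Rightarrow> ('a \<Rightarrow> complex) \<Rightarrow> ('a \<Rightarrow> complex) \<Rightarrow> 'a \<Rightarrow> complex" where
  "pi_op M r \<theta> u f = (\<lambda>x. u x * of_real (enn2real (RN_deriv M (distr M M \<theta>) x) powr (1 / r))
       * f (inv_into (space M) \<theta> x))"

definition H1_sharp_vanishes :: "'a measure \<Rightarrow> real \<Rightarrow> ('g \<Rightarrow> 'a \<Rightarrow> 'a) \<Rightarrow> ('g \<Rightarrow> 'a \<Rightarrow> complex) \<Rightarrow> bool" where
  "H1_sharp_vanishes M r \<sigma> \<omega> \<longleftrightarrow>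
    (\<forall>f \<in> borel_measurable M.
       (\<forall>g. memLp M r (\<lambda>x. pi_op M r (\<sigma> g) (\<omega> g) f x - f x)) \<longrightarrow>
       (\<exists>h. memLp M r h \<and> (\<forall>g. AE x in M.
           pi_op M r (\<sigma> g) (\<omega> g) f x - f x = pi_op M r (\<sigma> g) (\<omega> g) h x - h x)))"

end

theory Submission
  imports Defs
begin

text \<open>
  The Mazur map \<open>m(x) = |x|\<^sup>s sgn x\<close> with \<open>s = p/q\<close> intertwines \<open>\<pi>\<^sup>p\<close> and \<open>\<pi>\<^sup>q\<close>, and it is
  \<open>s\<close>-Hoelder. Hence, if the coboundary of \<open>f\<close> lies in \<open>L\<^sub>p\<close>, that of \<open>m f\<close> lies in \<open>L\<^sub>q\<close>, and the
  hypothesis yields a \<open>\<pi>\<^sup>p\<close>-invariant \<open>k\<close> with \<open>m f - m k \<in> L\<^sub>q\<close>. This does not give \<open>f - k \<in> L\<^sub>p\<close>,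
  because the inverse of \<open>m\<close> only satisfies \<open>|x - y|\<^sup>p \<le> \<epsilon> |x|\<^sup>p + C |m x - m y|\<^sup>q\<close> with \<open>C\<close> depending
  on \<open>\<epsilon>\<close>.

  Approximate \<open>f\<close> by \<open>k\<close> in this sense, and then \<open>f - k\<close> by an invariant \<open>l\<close>. The ratio
  \<open>|k| / |l|\<close> is invariant, and \<open>f - k\<close> is \<open>p\<close>-integrable wherever the ratio is bounded or \<open>l = 0\<close>,
  hence on each of countably many invariant pieces. On the \<open>n\<close>-th piece subtract an invariant function
  whose \<open>L\<^sub>p\<close>-distance to \<open>f - k\<close> is optimal up to \<open>2\<^sup>-\<^sup>n\<close>, and approximate the difference \<open>h\<close> once more
  by an invariant \<open>j\<close>. By near-optimality, subtracting \<open>j\<close> cannot decrease \<open>\<integral>|h|\<^sup>p\<close> over the piece by more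
  than \<open>2\<^sup>-\<^sup>n\<close>, while the inequality with \<open>\<epsilon> = 1/2\<close> says that it halves it up to \<open>C \<integral>|m h - m j|\<^sup>q\<close>.
  Thus the integrals of \<open>|h|\<^sup>p\<close> over the pieces are summable.
\<close>

section \<open>Mazur maps\<close>

lemma abs_powr_diff_le:
  fixes x y s :: real
  assumes s: "0 < s" "s \<le> 1" and "0 \<le> x" "0 \<le> y"
  shows "\<bar>x powr s - y powr s\<bar> \<le> \<bar>x - y\<bar> powr s"
  using \<open>0 \<le> x\<close> \<open>0 \<le> y\<close>
proof (induction x y rule: linorder_wlog)
  case (le x y)
  show ?case
  proof (cases "y = 0")
    case False
    have "t \<le> t powr s" if "0 \<le> t" "t \<le> 1" for t :: real
      using powr_mono' [of s 1 t] s that by simp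
    then have "x / y + (y - x) / y \<le> (x / y) powr s + ((y - x) / y) powr s"
      using le False by (intro add_mono) auto
    moreover have "x / y + (y - x) / y = 1"
      using False by (simp add: diff_divide_distrib)
    ultimately have "1 \<le> (x powr s + (y - x) powr s) / y powr s"
      using le False by (simp add: powr_divide add_divide_distrib)
    then have "y powr s - x powr s \<le> (y - x) powr s"
      using False by (simp add: le_divide_eq)
    moreover have "x powr s \<le> y powr s"
      using le s by (intro powr_mono2) auto
    ultimately show ?thesis
      using le by simp
  qed (use le in simp)
qed (simp add: abs_minus_commute)

lemma abs_powr_diff_le_relative:
  fixes \<epsilon> s :: real
  assumes \<epsilon>: "0 < \<epsilon>"
  obtains \<delta> where "0 < \<delta>"
    "\<And>x y. \<lbrakk>0 \<le> x; 0 \<le> y; \<bar>x - y\<bar> \<le> \<delta> * x\<rbrakk> \<Longrightarrow> \<bar>x powr s - y powr s\<bar> \<le> \<epsilon> * x powr s"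
proof -
  have "isCont (\<lambda>t :: real. t powr s) 1"
    by (intro continuous_intros) auto
  then obtain d where d: "0 < d" "\<And>t :: real. \<bar>t - 1\<bar> < d \<Longrightarrow> \<bar>t powr s - 1\<bar> < \<epsilon>"
    unfolding continuous_at_eps_delta dist_real_def using \<epsilon> by (metis powr_one_eq_one)
  have "\<bar>x powr s - y powr s\<bar> \<le> \<epsilon> * x powr s"
    if "0 \<le> x" "0 \<le> y" "\<bar>x - y\<bar> \<le> d / 2 * x" for x y
  proof (cases "x = 0")
    case False
    then have "0 < d * x"
      using d(1) that(1) by simp
    with that(3) have "\<bar>y - x\<bar> < d * x"
      by linarith
    then have "\<bar>y / x - 1\<bar> < d"
      using that False by (simp add: field_simps abs_less_iff)
    then have "\<bar>(y / x) powr s - 1\<bar> < \<epsilon>"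
      by (rule d(2))
    then have "\<bar>(y / x) powr s - 1\<bar> * x powr s \<le> \<epsilon> * x powr s"
      by (intro mult_right_mono) auto
    moreover have "x powr s - y powr s = (1 - (y / x) powr s) * x powr s"
      using that False by (simp add: powr_divide algebra_simps)
    ultimately show ?thesis
      by (simp add: abs_mult abs_minus_commute)
  qed (use that in simp)
  then show thesis
    using that [of "d / 2"] d(1) by simp
qed

lemma add_powr_le:
  fixes x y r :: real
  assumes "0 \<le> r" "0 \<le> x" "0 \<le> y"
  shows "(x + y) powr r \<le> 2 powr r * (x powr r + y powr r)"
proof -
  have "(x + y) powr r \<le> (2 * max x y) powr r"
    using assms by (intro powr_mono2) auto
  also have "\<dots> = 2 powr r * max x y powr r"
    by (simp add: powr_mult)
  also have "\<dots> \<le> 2 powr r * (x powr r + y powr r)"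
    by (intro mult_left_mono) (auto simp: max_def)
  finally show ?thesis .
qed

lemma norm_scaleR_sgn [simp]: "norm x *\<^sub>R sgn x = x"
  by (cases "x = 0") (simp_all add: sgn_div_norm)

lemma norm_mult_norm_sgn_diff_le:
  fixes x y :: "'a::real_normed_vector"
  shows "norm x * norm (sgn x - sgn y) \<le> 2 * norm (x - y)"
proof -
  have "norm x *\<^sub>R (sgn x - sgn y) = (x - y) + (norm y - norm x) *\<^sub>R sgn y"
    by (simp add: algebra_simps)
  then have "norm x * norm (sgn x - sgn y) = norm ((x - y) + (norm y - norm x) *\<^sub>R sgn y)"
    by (metis abs_norm_cancel norm_scaleR)
  also have "\<dots> \<le> norm (x - y) + \<bar>norm y - norm x\<bar> * norm (sgn y)"
    by (metis norm_scaleR norm_triangle_ineq)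
  also have "\<dots> \<le> norm (x - y) + norm (x - y) * 1"
    using norm_triangle_ineq3 [of y x]
    by (intro add_left_mono mult_mono) (auto simp: norm_sgn norm_minus_commute)
  finally show ?thesis by simp
qed

definition mazur :: "real \<Rightarrow> 'a::real_normed_vector \<Rightarrow> 'a" where
  "mazur s x = norm x powr s *\<^sub>R sgn x"

abbreviation mazur_diff :: "real \<Rightarrow> 'a::real_normed_vector \<Rightarrow> 'a \<Rightarrow> 'a" where
  "mazur_diff s x y \<equiv> mazur s x - mazur s y"

lemma norm_mazur [simp]: "norm (mazur s x) = norm x powr s"
  by (cases "x = 0") (simp_all add: mazur_def norm_sgn)

lemma mazur_0 [simp]: "mazur s 0 = 0"
  by (simp add: mazur_def)

lemma mazur_mult:
  fixes x y :: "'a::real_normed_div_algebra"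
  shows "mazur s (x * y) = mazur s x * mazur s y"
  by (simp add: mazur_def norm_mult powr_mult Real_Vector_Spaces.sgn_mult mult.commute)

lemma mazur_of_real:
  "0 \<le> d \<Longrightarrow> mazur s (of_real d :: 'a::real_normed_algebra_1) = of_real (d powr s)"
  by (cases "d = 0") (simp_all add: mazur_def sgn_of_real scaleR_conv_of_real)

lemma mazur_unit: "norm u = 1 \<Longrightarrow> mazur s u = u"
  by (simp add: mazur_def sgn_div_norm)

lemma mazur_mazur: "mazur s (mazur t x) = mazur (t * s) x"
proof (cases "x = 0")
  case False
  then have "sgn (mazur t x) = sgn x"
    by (simp add: mazur_def sgn_scaleR norm_sgn sgn_div_norm [of "sgn x"])
  then show ?thesis
    by (simp add: mazur_def [of s] mazur_def [of "t * s"] powr_powr)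
qed simp

lemma mazur_exponent_1 [simp]: "mazur 1 x = x"
  by (simp add: mazur_def)

lemma borel_measurable_mazur [measurable]:
  "(mazur s :: 'a::{real_normed_vector, second_countable_topology} \<Rightarrow> 'a) \<in> borel_measurable borel"
  unfolding mazur_def [abs_def] sgn_div_norm by measurable

lemma norm_mazur_diff_le:
  "norm (mazur_diff s x y) \<le>
     norm x powr s * norm (sgn x - sgn y) + \<bar>norm x powr s - norm y powr s\<bar>"
proof -
  have "mazur_diff s x y =
      norm x powr s *\<^sub>R (sgn x - sgn y) + (norm x powr s - norm y powr s) *\<^sub>R sgn y"
    by (simp add: mazur_def algebra_simps)
  also have "norm \<dots> \<le> norm x powr s * norm (sgn x - sgn y) +
      \<bar>norm x powr s - norm y powr s\<bar> * norm (sgn y)"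
    by (rule norm_triangle_le) simp
  also have "\<dots> \<le> norm x powr s * norm (sgn x - sgn y) + \<bar>norm x powr s - norm y powr s\<bar> * 1"
    by (intro add_left_mono mult_left_mono) (auto simp: norm_sgn)
  finally show ?thesis by simp
qed

lemma mazur_holder:
  assumes s: "0 < s" "s \<le> 1"
  shows "norm (mazur_diff s x y) \<le> 3 * norm (x - y) powr s"
proof -
  define D where "D = norm (sgn x - sgn y)"
  have "D \<le> norm (sgn x) + norm (sgn y)"
    unfolding D_def by (rule norm_triangle_ineq4)
  then have "D \<le> 2"
    by (simp add: norm_sgn split: if_splits)
  have factors: "(norm x * D) powr s \<le> (2 * norm (x - y)) powr s" "D powr (1 - s) \<le> 2 powr (1 - s)"
    using s \<open>D \<le> 2\<close> norm_mult_norm_sgn_diff_le [of x y]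
    by (auto simp: D_def intro!: powr_mono2)
  have "norm x powr s * D = (norm x * D) powr s * D powr (1 - s)"
    by (simp add: D_def powr_mult mult.assoc flip: powr_add)
  also have "\<dots> \<le> (2 * norm (x - y)) powr s * 2 powr (1 - s)"
    using factors by (rule mult_mono) auto
  also have "\<dots> = (2 powr s * 2 powr (1 - s)) * norm (x - y) powr s"
    by (simp add: powr_mult)
  also have "\<dots> = 2 * norm (x - y) powr s"
    by (simp flip: powr_add)
  finally have "norm x powr s * D \<le> 2 * norm (x - y) powr s" .
  moreover have "\<bar>norm x powr s - norm y powr s\<bar> \<le> norm (x - y) powr s"
    using abs_powr_diff_le [OF s, of "norm x" "norm y"]
      powr_mono2 [of s "\<bar>norm x - norm y\<bar>" "norm (x - y)"] s norm_triangle_ineq3 [of x y]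
    by simp
  ultimately show ?thesis
    using norm_mazur_diff_le [of s x y] by (simp add: D_def)
qed

lemma norm_mazur_diff_le_relative:
  assumes \<epsilon>: "0 < \<epsilon>"
  obtains \<delta> where "0 < \<delta>"
    "\<And>x y :: 'a::real_normed_vector. norm (x - y) \<le> \<delta> * norm x \<Longrightarrow>
       norm (mazur_diff s x y) \<le> \<epsilon> * norm x powr s"
proof -
  obtain d where d: "0 < d"
    "\<And>a b. \<lbrakk>0 \<le> a; 0 \<le> b; \<bar>a - b\<bar> \<le> d * a\<rbrakk> \<Longrightarrow> \<bar>a powr s - b powr s\<bar> \<le> \<epsilon> / 2 * a powr s"
    using abs_powr_diff_le_relative [of "\<epsilon> / 2" s] \<epsilon> by auto
  define \<delta> where "\<delta> = min d (\<epsilon> / 4)"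
  have "norm (mazur_diff s x y) \<le> \<epsilon> * norm x powr s"
    if close: "norm (x - y) \<le> \<delta> * norm x" for x y :: 'a
  proof (cases "x = 0")
    case False
    have "\<delta> * norm x \<le> d * norm x" "\<delta> * norm x \<le> \<epsilon> / 4 * norm x"
      by (intro mult_right_mono; simp add: \<delta>_def)+
    with close have diff: "norm (x - y) \<le> d * norm x" "norm (x - y) \<le> \<epsilon> / 4 * norm x"
      by linarith+
    have "norm x * norm (sgn x - sgn y) \<le> norm x * (\<epsilon> / 2)"
      using norm_mult_norm_sgn_diff_le [of x y] diff(2) by (simp add: mult.commute)
    then have "norm (sgn x - sgn y) \<le> \<epsilon> / 2"
      using False by simp
    then have "norm x powr s * norm (sgn x - sgn y) \<le> norm x powr s * (\<epsilon> / 2)"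
      by (intro mult_left_mono) auto
    moreover have "\<bar>norm x powr s - norm y powr s\<bar> \<le> \<epsilon> / 2 * norm x powr s"
      using norm_triangle_ineq3 [of x y] diff(1) by (intro d(2)) auto
    ultimately show ?thesis
      using norm_mazur_diff_le [of s x y] by (simp add: mult.commute)
  qed (use close in simp)
  moreover have "0 < \<delta>"
    using d \<epsilon> by (simp add: \<delta>_def)
  ultimately show thesis
    using that by blast
qed

lemma norm_mazur_diff_le_epsilon:
  fixes \<epsilon> s :: real
  assumes s: "0 \<le> s" and \<epsilon>: "0 < \<epsilon>"
  obtains C where "0 \<le> C"
    "\<And>x y :: 'a::real_normed_vector.
       norm (mazur_diff s x y) \<le> \<epsilon> * norm x powr s + C * norm (x - y) powr s"
proof -
  obtain \<delta> where \<delta>: "0 < \<delta>"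
    "\<And>x y :: 'a. norm (x - y) \<le> \<delta> * norm x \<Longrightarrow> norm (mazur_diff s x y) \<le> \<epsilon> * norm x powr s"
    using norm_mazur_diff_le_relative [OF \<epsilon>] by blast
  define C where "C = 2 * (1 + 1 / \<delta>) powr s"
  have "norm (mazur_diff s x y) \<le> \<epsilon> * norm x powr s + C * norm (x - y) powr s" for x y :: 'a
  proof (cases "norm (x - y) \<le> \<delta> * norm x")
    case True
    then show ?thesis
      using \<delta>(2) [of x y] by (simp add: C_def add_increasing2)
  next
    case False
    define R where "R = (1 + 1 / \<delta>) * norm (x - y)"
    have "norm x \<le> norm (x - y) / \<delta>" "R = norm (x - y) + norm (x - y) / \<delta>"
      using False \<delta>(1) by (simp_all add: R_def field_simps)
    then have "norm x \<le> R" "norm y \<le> R"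
      using norm_triangle_sub [of y x] norm_minus_commute [of x y] norm_ge_zero [of "x - y"] by linarith+
    have "norm (mazur_diff s x y) \<le> norm x powr s + norm y powr s"
      using norm_triangle_ineq4 [of "mazur s x" "mazur s y"] by simp
    also have "\<dots> \<le> R powr s + R powr s"
      using \<open>norm x \<le> R\<close> \<open>norm y \<le> R\<close> s by (intro add_mono powr_mono2) auto
    also have "\<dots> = C * norm (x - y) powr s"
      by (simp add: R_def C_def powr_mult)
    finally show ?thesis
      using \<epsilon> by (simp add: add_increasing)
  qed
  moreover have "0 \<le> C" by (simp add: C_def)
  ultimately show thesis using that by blast
qed

lemma norm_diff_powr_le_mazur:
  assumes p: "0 < p" and q: "0 < q" and \<epsilon>: "0 < \<epsilon>"
  obtains C where "0 \<le> C"
    "\<And>x y :: 'a::real_normed_vector.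
       norm (x - y) powr p \<le> \<epsilon> * norm x powr p + C * norm (mazur_diff (p / q) x y) powr q"
proof -
  define \<eta> where "\<eta> = \<epsilon> powr (1 / p) / 2"
  have \<eta>: "2 powr p * \<eta> powr p = \<epsilon>"
    using p \<epsilon> by (simp add: \<eta>_def powr_powr flip: powr_mult)
  obtain C where C: "0 \<le> C"
    "\<And>a b :: 'a. norm (mazur_diff (q / p) a b)
       \<le> \<eta> * norm a powr (q / p) + C * norm (a - b) powr (q / p)"
    using norm_mazur_diff_le_epsilon [of "q / p" \<eta>] p q \<epsilon> by (auto simp: \<eta>_def)
  have "norm (x - y) powr p
      \<le> \<epsilon> * norm x powr p + (2 powr p * C powr p) * norm (mazur_diff (p / q) x y) powr q"
    for x y :: 'a
  proof -
    define d where "d = norm (mazur_diff (p / q) x y)"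
    have "norm (x - y) \<le> \<eta> * norm x + C * d powr (q / p)"
      using C(2) [of "mazur (p / q) x" "mazur (p / q) y"] p q
      by (simp add: mazur_mazur powr_powr d_def)
    then have "norm (x - y) powr p \<le> (\<eta> * norm x + C * d powr (q / p)) powr p"
      using p by (intro powr_mono2) auto
    also have "\<dots> \<le> 2 powr p * ((\<eta> * norm x) powr p + (C * d powr (q / p)) powr p)"
      using p C(1) by (intro add_powr_le) (auto simp: \<eta>_def)
    also have "\<dots> = (2 powr p * \<eta> powr p) * norm x powr p + (2 powr p * C powr p) * d powr q"
      using p by (simp add: powr_mult powr_powr algebra_simps)
    finally show ?thesis
      by (simp add: \<eta> d_def)
  qed
  then show thesis
    using that [of "2 powr p * C powr p"] by simp
qed

lemma norm_mazur_powr: "0 < q \<Longrightarrow> norm (mazur (p / q) x) powr q = norm x powr p"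
  by (simp add: powr_powr)

lemma norm_powr_le_mazur_diff:
  assumes p: "0 < p" and q: "0 < q" and yz: "norm y \<le> c * norm z"
  shows "norm y powr p
    \<le> (c powr p * 2 powr q) * (norm x powr p + norm (mazur_diff (p / q) x z) powr q)"
proof -
  have "norm (mazur (p / q) z) \<le> norm (mazur (p / q) x) + norm (mazur_diff (p / q) x z)"
    by (metis norm_minus_commute norm_triangle_sub)
  then have "norm (mazur (p / q) z) powr q
      \<le> (norm (mazur (p / q) x) + norm (mazur_diff (p / q) x z)) powr q"
    using q by (intro powr_mono2) auto
  also have "\<dots> \<le> 2 powr q *
      (norm (mazur (p / q) x) powr q + norm (mazur_diff (p / q) x z) powr q)"
    using q by (intro add_powr_le) auto
  finally have z: "norm z powr p
      \<le> 2 powr q * (norm x powr p + norm (mazur_diff (p / q) x z) powr q)"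
    by (simp only: norm_mazur_powr [OF q])
  have "norm y powr p \<le> (c * norm z) powr p"
    using yz p by (intro powr_mono2) auto
  also have "\<dots> = c powr p * norm z powr p"
    by (simp add: powr_mult)
  finally show ?thesis
    using mult_left_mono [OF z, of "c powr p"] by simp
qed

lemma norm_diff_powr_le_mazur_remainders:
  assumes p: "0 < p" and q: "0 < q"
  obtains C where "0 \<le> C"
    "\<And>x y z :: 'a::real_normed_vector. norm y \<le> c * norm z \<or> z = 0 \<Longrightarrow>
       norm (x - y) powr p \<le> C * (norm (mazur_diff (p / q) x y) powr q +
         norm (mazur_diff (p / q) (x - y) z) powr q)"
proof -
  define B where "B = c powr p * 2 powr q"
  define \<epsilon> where "\<epsilon> = 1 / (2 * B + 1)"
  have "0 \<le> B" by (simp add: B_def)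
  then have \<epsilon>: "0 < \<epsilon>" "\<epsilon> * B \<le> 1 / 2"
    by (auto simp: \<epsilon>_def field_simps)
  obtain C where C: "0 \<le> C"
    "\<And>x y :: 'a. norm (x - y) powr p
       \<le> \<epsilon> * norm x powr p + C * norm (mazur_diff (p / q) x y) powr q"
    using norm_diff_powr_le_mazur [OF p q \<epsilon>(1)] by blast
  have "norm (x - y) powr p \<le> (2 * C + 1) *
      (norm (mazur_diff (p / q) x y) powr q +
       norm (mazur_diff (p / q) (x - y) z) powr q)" (is "_ \<le> _ * (?D + ?E)")
    if "norm y \<le> c * norm z \<or> z = 0" for x y z :: 'a
    using that
  proof
    assume "z = 0"
    then have "norm (x - y) powr p = ?E"
      using norm_mazur_powr [OF q, of p "x - y"] by simp
    then show ?thesis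
      using C(1) by (simp add: algebra_simps)
  next
    assume "norm y \<le> c * norm z"
    from norm_powr_le_mazur_diff [OF p q this, of "x - y"]
    have "\<epsilon> * norm y powr p \<le> (\<epsilon> * B) * (norm (x - y) powr p + ?E)"
      using \<epsilon>(1) by (simp add: B_def mult.assoc)
    also have "\<dots> \<le> 1 / 2 * (norm (x - y) powr p + ?E)"
      using \<epsilon>(2) by (intro mult_right_mono) auto
    finally have "\<epsilon> * norm y powr p \<le> 1 / 2 * (norm (x - y) powr p + ?E)" .
    moreover have "norm (x - y) powr p \<le> \<epsilon> * norm y powr p + C * ?D"
      using C(2) [of y x]
      by (simp add: norm_minus_commute [of y] norm_minus_commute [of "mazur (p / q) y"])
    moreover have "0 \<le> ?D" "0 \<le> C * ?E"
      using C(1) by auto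
    ultimately show ?thesis
      unfolding distrib_left distrib_right by linarith
  qed
  then show thesis
    using C(1) that [of "2 * C + 1"] by simp
qed

section \<open>Integrals of powers\<close>

definition Lp_norm_powr ::
  "'a measure \<Rightarrow> real \<Rightarrow> 'a set \<Rightarrow> ('a \<Rightarrow> 'b::real_normed_vector) \<Rightarrow> ennreal" where
  "Lp_norm_powr M r A h = (\<integral>\<^sup>+x\<in>A. ennreal (norm (h x) powr r) \<partial>M)"

lemma memLp_iff_Lp_norm_powr:
  "memLp M r h \<longleftrightarrow> h \<in> borel_measurable M \<and> Lp_norm_powr M r (space M) h < \<infinity>"
  by (auto simp: memLp_def Lp_norm_powr_def integrable_iff_bounded)

lemma memLp_dominated:
  assumes "h \<in> borel_measurable M" "integrable M \<phi>" "AE x in M. norm (h x) powr r \<le> \<phi> x"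
  shows "memLp M r h"
  unfolding memLp_def
proof
  show "integrable M (\<lambda>x. norm (h x) powr r)"
    using assms(2) by (rule Bochner_Integration.integrable_bound) (use assms in auto)
qed fact

lemma memLp_cong_AE:
  assumes "memLp M r f" "g \<in> borel_measurable M" "AE x in M. f x = g x"
  shows "memLp M r g"
  using assms by (intro memLp_dominated [where \<phi> = "\<lambda>x. norm (f x) powr r"]) (auto simp: memLp_def)

abbreviation fibre :: "'a measure \<Rightarrow> ('a \<Rightarrow> nat) \<Rightarrow> nat \<Rightarrow> 'a set" where
  "fibre M N n \<equiv> N -` {n} \<inter> space M"

lemma suminf_Lp_norm_powr_fibres:
  fixes N :: "'a \<Rightarrow> nat"
  assumes [measurable]: "h \<in> borel_measurable M" "N \<in> measurable M (count_space UNIV)"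
  shows "(\<Sum>n. Lp_norm_powr M r (fibre M N n) h) = Lp_norm_powr M r (space M) h"
proof -
  have "(\<Union>n. fibre M N n) = space M"
    by auto
  moreover have "disjoint_family (fibre M N)"
    by (auto simp: disjoint_family_on_def)
  ultimately show ?thesis
    using nn_integral_disjoint_family [of "\<lambda>x. ennreal (norm (h x) powr r)" M "fibre M N"]
    by (simp add: Lp_norm_powr_def)
qed

lemma memLp_if_fibrewise_le:
  fixes N :: "'a \<Rightarrow> nat"
  assumes h: "h \<in> borel_measurable M" and N: "N \<in> measurable M (count_space UNIV)"
    and d: "memLp M q d" and \<epsilon>: "(\<Sum>n. \<epsilon> n) < \<infinity>"
    and le: "\<And>n. Lp_norm_powr M p (fibre M N n) h
      \<le> ennreal C * Lp_norm_powr M q (fibre M N n) d + \<epsilon> n"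
  shows "memLp M p h"
proof -
  have "Lp_norm_powr M p (space M) h = (\<Sum>n. Lp_norm_powr M p (fibre M N n) h)"
    using h N by (rule suminf_Lp_norm_powr_fibres [symmetric])
  also have "\<dots> \<le> (\<Sum>n. ennreal C * Lp_norm_powr M q (fibre M N n) d + \<epsilon> n)"
    using le by (intro suminf_le) auto
  also have "\<dots> = ennreal C * Lp_norm_powr M q (space M) d + (\<Sum>n. \<epsilon> n)"
    using d N by (simp add: suminf_add [symmetric] suminf_Lp_norm_powr_fibres memLp_def)
  also have "\<dots> < \<infinity>"
    using d \<epsilon> by (simp add: memLp_iff_Lp_norm_powr ennreal_mult_less_top)
  finally show ?thesis
    using h by (simp add: memLp_iff_Lp_norm_powr)
qed

lemma Lp_norm_powr_finite_if_mazur_remainders: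
  fixes f k l :: "'a \<Rightarrow> complex"
  assumes p: "0 < p" and q: "0 < q"
    and fk: "memLp M q (\<lambda>x. mazur_diff (p / q) (f x) (k x))"
    and fkl: "memLp M q (\<lambda>x. mazur_diff (p / q) (f x - k x) (l x))"
    and kl: "\<And>x. x \<in> A \<Longrightarrow> norm (k x) \<le> c * norm (l x) \<or> l x = 0"
  shows "Lp_norm_powr M p A (\<lambda>x. f x - k x) < \<infinity>"
proof -
  obtain C where C: "0 \<le> C"
    "\<And>x y z :: complex. norm y \<le> c * norm z \<or> z = 0 \<Longrightarrow>
       norm (x - y) powr p \<le> C * (norm (mazur_diff (p / q) x y) powr q +
         norm (mazur_diff (p / q) (x - y) z) powr q)"
    using norm_diff_powr_le_mazur_remainders [OF p q] by blast
  define \<phi> where "\<phi> x = C * (norm (mazur_diff (p / q) (f x) (k x)) powr q +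
    norm (mazur_diff (p / q) (f x - k x) (l x)) powr q)" for x
  have "integrable M \<phi>"
    using fk fkl by (simp add: \<phi>_def [abs_def] memLp_def)
  have "Lp_norm_powr M p A (\<lambda>x. f x - k x) \<le> (\<integral>\<^sup>+x. ennreal (norm (\<phi> x)) \<partial>M)"
    unfolding Lp_norm_powr_def
  proof (intro nn_integral_mono)
    fix x
    have "norm (f x - k x) powr p \<le> \<phi> x" if "x \<in> A"
      using C(2) [OF kl [OF that]] by (simp add: \<phi>_def)
    then show "ennreal (norm (f x - k x) powr p) * indicator A x \<le> ennreal (norm (\<phi> x))"
      by (auto simp: indicator_def intro!: ennreal_leI)
  qed
  also have "\<dots> < \<infinity>"
    using \<open>integrable M \<phi>\<close> by (simp add: integrable_iff_bounded)
  finally show ?thesis .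
qed

lemma Lp_norm_powr_diff_le_mazur:
  fixes h k :: "'a \<Rightarrow> 'b::{real_normed_vector, second_countable_topology}"
  assumes p: "0 < p" and q: "0 < q"
    and [measurable]: "h \<in> borel_measurable M" "k \<in> borel_measurable M"
  obtains C where "\<And>A. A \<in> sets M \<Longrightarrow>
    2 * Lp_norm_powr M p A (\<lambda>x. h x - k x) \<le> Lp_norm_powr M p A h +
      ennreal C * Lp_norm_powr M q A (\<lambda>x. mazur_diff (p / q) (h x) (k x))"
proof -
  obtain C where C: "0 \<le> C" "\<And>x y :: 'b. norm (x - y) powr p
      \<le> 1 / 2 * norm x powr p + C * norm (mazur_diff (p / q) x y) powr q"
    using norm_diff_powr_le_mazur [OF p q, of "1 / 2"] by auto
  have pointwise: "2 * ennreal (norm (x - y) powr p) \<le> ennreal (norm x powr p) +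
      ennreal (2 * C) * ennreal (norm (mazur_diff (p / q) x y) powr q)" for x y :: 'b
  proof -
    have "2 * norm (x - y) powr p
        \<le> norm x powr p + (2 * C) * norm (mazur_diff (p / q) x y) powr q"
      using C(2) [of x y] by simp
    from ennreal_leI [OF this] show ?thesis
      using C(1) by (simp add: ennreal_mult)
  qed
  show thesis
  proof
    fix A assume [measurable]: "A \<in> sets M"
    have "(\<integral>\<^sup>+x. 2 * (ennreal (norm (h x - k x) powr p) * indicator A x) \<partial>M) \<le>
        (\<integral>\<^sup>+x. ennreal (norm (h x) powr p) * indicator A x + ennreal (2 * C) *
          (ennreal (norm (mazur_diff (p / q) (h x) (k x)) powr q) * indicator A x) \<partial>M)"
      using pointwise by (intro nn_integral_mono) (auto simp: indicator_def)
    then show "2 * Lp_norm_powr M p A (\<lambda>x. h x - k x) \<le> Lp_norm_powr M p A h +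
        ennreal (2 * C) * Lp_norm_powr M q A (\<lambda>x. mazur_diff (p / q) (h x) (k x))"
      by (simp add: Lp_norm_powr_def nn_integral_add nn_integral_cmult)
  qed
qed

lemma Lp_norm_powr_le_if_near_minimal:
  fixes h k :: "'a \<Rightarrow> 'b::{real_normed_vector, second_countable_topology}"
  assumes p: "0 < p" and q: "0 < q"
    and h: "h \<in> borel_measurable M" and k: "k \<in> borel_measurable M"
  obtains C where "\<And>A \<epsilon>. \<lbrakk>A \<in> sets M; Lp_norm_powr M p A h < \<infinity>;
      Lp_norm_powr M p A h \<le> Lp_norm_powr M p A (\<lambda>x. h x - k x) + \<epsilon>\<rbrakk> \<Longrightarrow>
    Lp_norm_powr M p A h
      \<le> ennreal C * Lp_norm_powr M q A (\<lambda>x. mazur_diff (p / q) (h x) (k x)) + 2 * \<epsilon>"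
proof -
  obtain C where C: "\<And>A. A \<in> sets M \<Longrightarrow>
      2 * Lp_norm_powr M p A (\<lambda>x. h x - k x) \<le> Lp_norm_powr M p A h +
        ennreal C * Lp_norm_powr M q A (\<lambda>x. mazur_diff (p / q) (h x) (k x))"
    using Lp_norm_powr_diff_le_mazur [OF p q h k] by blast
  show thesis
  proof
    fix A \<epsilon>
    assume A: "A \<in> sets M" and finite: "Lp_norm_powr M p A h < \<infinity>"
      and near_minimal: "Lp_norm_powr M p A h \<le> Lp_norm_powr M p A (\<lambda>x. h x - k x) + \<epsilon>"
    have "2 * Lp_norm_powr M p A h \<le> 2 * Lp_norm_powr M p A (\<lambda>x. h x - k x) + 2 * \<epsilon>"
      unfolding distrib_left [symmetric] using near_minimal by (rule mult_left_mono) simp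
    also have "\<dots> \<le> Lp_norm_powr M p A h +
        ennreal C * Lp_norm_powr M q A (\<lambda>x. mazur_diff (p / q) (h x) (k x)) + 2 * \<epsilon>"
      by (intro add_right_mono C A)
    finally show "Lp_norm_powr M p A h
        \<le> ennreal C * Lp_norm_powr M q A (\<lambda>x. mazur_diff (p / q) (h x) (k x)) + 2 * \<epsilon>"
      using finite by (auto simp: mult_2 [of "Lp_norm_powr M p A h"] add.assoc ennreal_add_left_cancel_le)
  qed
qed

lemma ennreal_near_minimum:
  fixes F :: "'a \<Rightarrow> ennreal"
  assumes "S \<noteq> {}" "0 < \<epsilon>"
  obtains v where "v \<in> S" "\<And>u. u \<in> S \<Longrightarrow> F v \<le> F u + ennreal \<epsilon>"
proof (cases "(INF u\<in>S. F u) = \<infinity>")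
  case True
  then show thesis
    using assms(1) that by (auto simp: INF_top_conv)
next
  case False
  then obtain v where "v \<in> S" "F v < (INF u\<in>S. F u) + ennreal \<epsilon>"
    using INF_approx_ennreal [of \<epsilon> _ F S] assms(2) by (auto simp: less_le)
  moreover have "(INF u\<in>S. F u) + ennreal \<epsilon> \<le> F u + ennreal \<epsilon>" if "u \<in> S" for u
    using that by (intro add_right_mono INF_lower)
  ultimately show thesis
    using that by (meson less_imp_le order_trans)
qed

section \<open>Twisted actions of nonsingular automorphisms\<close>

lemma pi_op_diff:
  "pi_op M r \<theta> u (\<lambda>x. f x - h x) x = pi_op M r \<theta> u f x - pi_op M r \<theta> u h x"
  by (simp add: pi_op_def algebra_simps)

lemma pi_op_add:
  "pi_op M r \<theta> u (\<lambda>x. f x + h x) x = pi_op M r \<theta> u f x + pi_op M r \<theta> u h x"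
  by (simp add: pi_op_def algebra_simps)

lemma pi_op_mazur:
  assumes "norm (u x) = 1" "0 < r"
  shows "pi_op M t \<theta> u (\<lambda>x. mazur (r / t) (f x)) x = mazur (r / t) (pi_op M r \<theta> u f x)"
  using assms by (simp add: pi_op_def mazur_mult mazur_unit mazur_of_real powr_powr)

lemma borel_measurable_pi_op:
  assumes "nonsing_aut M \<theta>" and [measurable]: "u \<in> borel_measurable M" "f \<in> borel_measurable M"
  shows "pi_op M r \<theta> u f \<in> borel_measurable M"
proof -
  have [measurable]: "inv_into (space M) \<theta> \<in> measurable M M"
    using assms by (simp add: nonsing_aut_def)
  show ?thesis unfolding pi_op_def by measurable
qed

locale twisted_automorphisms =
  fixes M :: "'a measure" and \<sigma> :: "'g \<Rightarrow> 'a \<Rightarrow> 'a" and \<omega> :: "'g \<Rightarrow> 'a \<Rightarrow> complex"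
  assumes nonsing: "nonsing_aut M (\<sigma> g)"
    and twist_measurable: "\<omega> g \<in> borel_measurable M"
    and norm_twist: "AE x in M. norm (\<omega> g x) = 1"
begin

abbreviation \<pi> :: "real \<Rightarrow> 'g \<Rightarrow> ('a \<Rightarrow> complex) \<Rightarrow> 'a \<Rightarrow> complex" where
  "\<pi> r g \<equiv> pi_op M r (\<sigma> g) (\<omega> g)"

definition invariant :: "real \<Rightarrow> ('a \<Rightarrow> complex) \<Rightarrow> bool" where
  "invariant r k \<longleftrightarrow> k \<in> borel_measurable M \<and> (\<forall>g. AE x in M. \<pi> r g k x = k x)"

definition has_Lp_coboundary :: "real \<Rightarrow> ('a \<Rightarrow> complex) \<Rightarrow> bool" where
  "has_Lp_coboundary r f \<longleftrightarrow> f \<in> borel_measurable M \<and> (\<forall>g. memLp M r (\<lambda>x. \<pi> r g f x - f x))"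

lemma invariant_measurable [measurable_dest]: "invariant r k \<Longrightarrow> k \<in> borel_measurable M"
  by (simp add: invariant_def)

lemma has_Lp_coboundary_measurable [measurable_dest]: "has_Lp_coboundary r f \<Longrightarrow> f \<in> borel_measurable M"
  by (simp add: has_Lp_coboundary_def)

lemma pi_op_measurable [measurable]: "f \<in> borel_measurable M \<Longrightarrow> \<pi> r g f \<in> borel_measurable M"
  using nonsing twist_measurable by (rule borel_measurable_pi_op)

lemma H1_sharp_vanishes_iff:
  "H1_sharp_vanishes M r \<sigma> \<omega> \<longleftrightarrow>
     (\<forall>f. has_Lp_coboundary r f \<longrightarrow> (\<exists>k. invariant r k \<and> memLp M r (\<lambda>x. f x - k x)))"
proof -
  have "(\<exists>h. memLp M r h \<and> (\<forall>g. AE x in M. \<pi> r g f x - f x = \<pi> r g h x - h x)) \<longleftrightarrow>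
      (\<exists>k. invariant r k \<and> memLp M r (\<lambda>x. f x - k x))" (is "?vanish f \<longleftrightarrow> ?approx f")
    if [measurable]: "f \<in> borel_measurable M" for f
  proof
    assume "?vanish f"
    then obtain h where h: "memLp M r h" "\<And>g. AE x in M. \<pi> r g f x - f x = \<pi> r g h x - h x"
      by blast
    have "AE x in M. \<pi> r g (\<lambda>x. f x - h x) x = f x - h x" for g
      using h(2) [of g] by eventually_elim (simp add: pi_op_diff algebra_simps)
    then have "invariant r (\<lambda>x. f x - h x)"
      using h(1) by (auto simp: invariant_def memLp_def)
    then show "?approx f"
      using h(1) by (intro exI [of _ "\<lambda>x. f x - h x"]) simp
  next
    assume "?approx f"
    then obtain k where k: "invariant r k" "memLp M r (\<lambda>x. f x - k x)"
      by blast
    have "AE x in M. \<pi> r g f x - f x = \<pi> r g (\<lambda>x. f x - k x) x - (f x - k x)" for g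
    proof -
      have "AE x in M. \<pi> r g k x = k x"
        using k(1) by (simp add: invariant_def)
      then show ?thesis by eventually_elim (simp add: pi_op_diff)
    qed
    then show "?vanish f"
      using k(2) by blast
  qed
  then show ?thesis
    unfolding H1_sharp_vanishes_def has_Lp_coboundary_def by blast
qed

lemma invariant_0: "invariant r (\<lambda>_. 0)"
  by (simp add: invariant_def pi_op_def)

lemma invariant_add:
  assumes "invariant r k" "invariant r l"
  shows "invariant r (\<lambda>x. k x + l x)"
proof -
  have "AE x in M. \<pi> r g (\<lambda>x. k x + l x) x = k x + l x" for g
  proof -
    have "AE x in M. \<pi> r g k x = k x" "AE x in M. \<pi> r g l x = l x"
      using assms by (auto simp: invariant_def)
    then show ?thesis by eventually_elim (simp add: pi_op_add)
  qed
  then show ?thesis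
    using assms by (auto simp: invariant_def)
qed

lemma invariant_mazur:
  assumes k: "invariant r k" and r: "0 < r"
  shows "invariant t (\<lambda>x. mazur (r / t) (k x))"
proof -
  have "AE x in M. \<pi> t g (\<lambda>x. mazur (r / t) (k x)) x = mazur (r / t) (k x)" for g
  proof -
    have "AE x in M. \<pi> r g k x = k x"
      using k by (simp add: invariant_def)
    with norm_twist [of g] show ?thesis
      by eventually_elim (simp add: r pi_op_mazur)
  qed
  then show ?thesis
    using invariant_measurable [OF k] by (simp add: invariant_def)
qed

lemma has_Lp_coboundary_diff_invariant:
  assumes f: "has_Lp_coboundary r f" and k: "invariant r k"
  shows "has_Lp_coboundary r (\<lambda>x. f x - k x)"
proof -
  note [measurable] = has_Lp_coboundary_measurable [OF f] invariant_measurable [OF k]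
  have "memLp M r (\<lambda>x. \<pi> r g (\<lambda>x. f x - k x) x - (f x - k x))" for g
  proof (rule memLp_cong_AE)
    show "memLp M r (\<lambda>x. \<pi> r g f x - f x)"
      using f by (simp add: has_Lp_coboundary_def)
    have "AE x in M. \<pi> r g k x = k x"
      using k by (simp add: invariant_def)
    then show "AE x in M. \<pi> r g f x - f x = \<pi> r g (\<lambda>x. f x - k x) x - (f x - k x)"
      by eventually_elim (simp add: pi_op_diff)
  qed measurable
  then show ?thesis
    by (simp add: has_Lp_coboundary_def)
qed

lemma has_Lp_coboundary_mazur:
  assumes p: "0 < p" and pq: "p \<le> q" and f: "has_Lp_coboundary p f"
  shows "has_Lp_coboundary q (\<lambda>x. mazur (p / q) (f x))"
proof -
  note [measurable] = has_Lp_coboundary_measurable [OF f]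
  have "memLp M q (\<lambda>x. \<pi> q g (\<lambda>x. mazur (p / q) (f x)) x - mazur (p / q) (f x))" for g
  proof (rule memLp_dominated)
    show "integrable M (\<lambda>x. 3 powr q * norm (\<pi> p g f x - f x) powr p)"
      using f by (simp add: has_Lp_coboundary_def memLp_def)
    show "AE x in M. norm (\<pi> q g (\<lambda>x. mazur (p / q) (f x)) x - mazur (p / q) (f x)) powr q
        \<le> 3 powr q * norm (\<pi> p g f x - f x) powr p"
      using norm_twist [of g]
    proof eventually_elim
      case (elim x)
      have "norm (\<pi> q g (\<lambda>x. mazur (p / q) (f x)) x - mazur (p / q) (f x))
          \<le> 3 * norm (\<pi> p g f x - f x) powr (p / q)"
        using elim p pq by (simp add: pi_op_mazur mazur_holder)
      then have "norm (\<pi> q g (\<lambda>x. mazur (p / q) (f x)) x - mazur (p / q) (f x)) powr q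
          \<le> (3 * norm (\<pi> p g f x - f x) powr (p / q)) powr q"
        using p pq by (intro powr_mono2) auto
      then show ?case
        using p pq by (simp add: powr_mult powr_powr)
    qed
  qed measurable
  then show ?thesis
    by (simp add: has_Lp_coboundary_def)
qed

lemma invariant_mazur_approximation:
  assumes p: "0 < p" and pq: "p \<le> q" and Hq: "H1_sharp_vanishes M q \<sigma> \<omega>" and f: "has_Lp_coboundary p f"
  obtains k where "invariant p k" "memLp M q (\<lambda>x. mazur_diff (p / q) (f x) (k x))"
proof -
  obtain K where K: "invariant q K" "memLp M q (\<lambda>x. mazur (p / q) (f x) - K x)"
    using Hq has_Lp_coboundary_mazur [OF p pq f] by (auto simp: H1_sharp_vanishes_iff)
  show thesis
  proof
    show "invariant p (\<lambda>x. mazur (q / p) (K x))"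
      using K(1) p pq by (intro invariant_mazur) auto
    show "memLp M q (\<lambda>x. mazur_diff (p / q) (f x) (mazur (q / p) (K x)))"
      using K(2) p pq by (simp add: mazur_mazur)
  qed
qed

text \<open>Where the Radon-Nikodym derivative vanishes, every invariant function vanishes too, so an
  index only needs to be invariant off that set.\<close>

definition invariant_index :: "('a \<Rightarrow> nat) \<Rightarrow> bool" where
  "invariant_index N \<longleftrightarrow> N \<in> measurable M (count_space UNIV) \<and>
     (\<forall>g. AE x in M. enn2real (RN_deriv M (distr M M (\<sigma> g)) x) = 0 \<or>
        N (inv_into (space M) (\<sigma> g) x) = N x)"

lemma invariant_glue:
  assumes N: "invariant_index N" and k: "\<And>n. invariant r (k n)"
  shows "invariant r (\<lambda>x. k (N x) x)"
proof -
  have "AE x in M. \<pi> r g (\<lambda>x. k (N x) x) x = k (N x) x" for g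
  proof -
    have "AE x in M. \<forall>n. \<pi> r g (k n) x = k n x"
      using k by (simp add: invariant_def AE_all_countable)
    moreover have "AE x in M. enn2real (RN_deriv M (distr M M (\<sigma> g)) x) = 0 \<or>
        N (inv_into (space M) (\<sigma> g) x) = N x"
      using N by (simp add: invariant_index_def)
    ultimately show ?thesis
    proof eventually_elim
      case (elim x)
      then show ?case
        using elim(1) [rule_format, of "N x"] by (auto simp: pi_op_def)
    qed
  qed
  moreover have [measurable]: "N \<in> measurable M (count_space UNIV)" "\<And>n. k n \<in> borel_measurable M"
    using N k by (auto simp: invariant_index_def invariant_def)
  ultimately show ?thesis
    by (simp add: invariant_def)
qed

lemma invariant_index_ratio:
  assumes k: "invariant r k" and l: "invariant r l"
  shows "invariant_index (\<lambda>x. nat \<lceil>norm (k x) / norm (l x)\<rceil>)" (is "invariant_index ?N")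
proof -
  have "AE x in M. enn2real (RN_deriv M (distr M M (\<sigma> g)) x) = 0 \<or>
      ?N (inv_into (space M) (\<sigma> g) x) = ?N x" for g
  proof -
    have "AE x in M. \<pi> r g k x = k x" "AE x in M. \<pi> r g l x = l x"
      using k l by (auto simp: invariant_def)
    with norm_twist [of g] show ?thesis
    proof eventually_elim
      case (elim x)
      have "norm (k x) = norm (\<pi> r g k x)" "norm (l x) = norm (\<pi> r g l x)"
        using elim by simp_all
      then show ?case
        using elim(1) by (auto simp: pi_op_def norm_mult)
    qed
  qed
  moreover have "?N \<in> measurable M (count_space UNIV)"
    using k l by measurable
  ultimately show ?thesis
    by (simp add: invariant_index_def)
qed

lemma invariant_near_best_approximation:
  assumes N: "invariant_index N" and \<epsilon>: "\<And>n. 0 < \<epsilon> n"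
  obtains w where "invariant r w"
    "\<And>n u. invariant r u \<Longrightarrow> Lp_norm_powr M p (fibre M N n) (\<lambda>x. f x - w x)
       \<le> Lp_norm_powr M p (fibre M N n) (\<lambda>x. f x - u x) + ennreal (\<epsilon> n)"
proof -
  define E where "E n v = Lp_norm_powr M p (fibre M N n) (\<lambda>x. f x - v x)" for n v
  have "\<exists>v. invariant r v \<and> (\<forall>u. invariant r u \<longrightarrow> E n v \<le> E n u + ennreal (\<epsilon> n))" for n
    using ennreal_near_minimum [of "Collect (invariant r)" "\<epsilon> n" "E n"] \<epsilon> [of n] invariant_0
    by (metis empty_iff mem_Collect_eq)
  then obtain v where v: "\<And>n. invariant r (v n)"
    "\<And>n u. invariant r u \<Longrightarrow> E n (v n) \<le> E n u + ennreal (\<epsilon> n)"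
    by metis
  have "E n (\<lambda>x. v (N x) x) = E n (v n)" for n
    unfolding E_def Lp_norm_powr_def by (intro nn_integral_cong) (auto simp: indicator_def)
  then show thesis
    using invariant_glue [OF N, of r v] v by (intro that [of "\<lambda>x. v (N x) x"]) (simp_all add: E_def)
qed

lemma invariant_approximation_if_fibrewise_Lp:
  assumes p: "0 < p" and pq: "p \<le> q" and Hq: "H1_sharp_vanishes M q \<sigma> \<omega>" and f: "has_Lp_coboundary p f"
    and N: "invariant_index N" and fN: "\<And>n. Lp_norm_powr M p (fibre M N n) f < \<infinity>"
  obtains w where "invariant p w" "memLp M p (\<lambda>x. f x - w x)"
proof -
  obtain w where w: "invariant p w"
    and w_opt: "\<And>n u. invariant p u \<Longrightarrow> Lp_norm_powr M p (fibre M N n) (\<lambda>x. f x - w x)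
      \<le> Lp_norm_powr M p (fibre M N n) (\<lambda>x. f x - u x) + ennreal ((1 / 2) ^ n)"
    using invariant_near_best_approximation [OF N, of "\<lambda>n. (1 / 2) ^ n" p p f] by auto
  define h where "h = (\<lambda>x. f x - w x)"
  have h: "has_Lp_coboundary p h"
    unfolding h_def using f w by (rule has_Lp_coboundary_diff_invariant)
  then obtain k where k: "invariant p k"
    and hk: "memLp M q (\<lambda>x. mazur_diff (p / q) (h x) (k x))"
    using invariant_mazur_approximation [OF p pq Hq] by blast
  have N_meas [measurable]: "N \<in> measurable M (count_space UNIV)"
    using N by (simp add: invariant_index_def)
  obtain C where C: "\<And>A \<epsilon>. \<lbrakk>A \<in> sets M; Lp_norm_powr M p A h < \<infinity>;
      Lp_norm_powr M p A h \<le> Lp_norm_powr M p A (\<lambda>x. h x - k x) + \<epsilon>\<rbrakk> \<Longrightarrow>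
    Lp_norm_powr M p A h
      \<le> ennreal C * Lp_norm_powr M q A (\<lambda>x. mazur_diff (p / q) (h x) (k x)) + 2 * \<epsilon>"
    using Lp_norm_powr_le_if_near_minimal [OF p less_le_trans [OF p pq]]
      has_Lp_coboundary_measurable [OF h] invariant_measurable [OF k] by blast
  have "memLp M p h"
  proof (rule memLp_if_fibrewise_le [OF has_Lp_coboundary_measurable [OF h] N_meas hk])
    have "(\<Sum>n. ennreal ((1 / 2) ^ n)) = ennreal 2"
      using geometric_sums [of "1 / 2 :: real"] by (intro suminf_ennreal_eq) auto
    then show "(\<Sum>n. 2 * ennreal ((1 / 2) ^ n)) < \<infinity>"
      by (simp add: ennreal_mult_less_top)
    show "Lp_norm_powr M p (fibre M N n) h \<le> ennreal C * Lp_norm_powr M q (fibre M N n)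
        (\<lambda>x. mazur_diff (p / q) (h x) (k x)) + 2 * ennreal ((1 / 2) ^ n)" for n
    proof (rule C)
      show "Lp_norm_powr M p (fibre M N n) h < \<infinity>"
        using w_opt [OF invariant_0, of n] fN [of n] by (auto simp: h_def intro: le_less_trans)
      show "Lp_norm_powr M p (fibre M N n) h
          \<le> Lp_norm_powr M p (fibre M N n) (\<lambda>x. h x - k x) + ennreal ((1 / 2) ^ n)"
        using w_opt [OF invariant_add [OF w k], of n] by (simp add: h_def diff_diff_eq)
    qed measurable
  qed
  then show thesis
    using w that by (simp add: h_def)
qed

theorem H1_sharp_vanishes_mono:
  assumes p: "0 < p" and pq: "p \<le> q" and Hq: "H1_sharp_vanishes M q \<sigma> \<omega>"
  shows "H1_sharp_vanishes M p \<sigma> \<omega>"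
  unfolding H1_sharp_vanishes_iff
proof (intro allI impI)
  fix f assume f: "has_Lp_coboundary p f"
  obtain k where k: "invariant p k"
    and fk: "memLp M q (\<lambda>x. mazur_diff (p / q) (f x) (k x))"
    using invariant_mazur_approximation [OF p pq Hq f] by blast
  have coboundary: "has_Lp_coboundary p (\<lambda>x. f x - k x)"
    using f k by (rule has_Lp_coboundary_diff_invariant)
  then obtain l where l: "invariant p l"
    and fkl: "memLp M q (\<lambda>x. mazur_diff (p / q) (f x - k x) (l x))"
    using invariant_mazur_approximation [OF p pq Hq] by blast
  \<comment> \<open>Division by zero puts the set \<open>l = 0\<close> into the fibre over \<open>0\<close>.\<close>
  define N where "N x = nat \<lceil>norm (k x) / norm (l x)\<rceil>" for x
  have N: "invariant_index N"
    unfolding N_def using k l by (rule invariant_index_ratio)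
  have "Lp_norm_powr M p (fibre M N n) (\<lambda>x. f x - k x) < \<infinity>" for n
  proof (rule Lp_norm_powr_finite_if_mazur_remainders [OF _ _ fk fkl])
    fix x assume "x \<in> fibre M N n"
    then have "norm (k x) / norm (l x) \<le> real n"
      unfolding N_def by simp linarith
    then show "norm (k x) \<le> real n * norm (l x) \<or> l x = 0"
      by (auto simp: divide_le_eq split: if_splits)
  qed (use p pq in auto)
  with coboundary N obtain w where w: "invariant p w" "memLp M p (\<lambda>x. (f x - k x) - w x)"
    using invariant_approximation_if_fibrewise_Lp [OF p pq Hq] by blast
  show "\<exists>k. invariant p k \<and> memLp M p (\<lambda>x. f x - k x)"
    using invariant_add [OF k w(1)] w(2) by (auto simp: diff_diff_eq)
qed

end

theorem theorem5p4:
  fixes M :: "'a measure"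
    and p q :: real
    and \<sigma> :: "'g::topological_group_add \<Rightarrow> 'a \<Rightarrow> 'a"
    and \<omega> :: "'g \<Rightarrow> 'a \<Rightarrow> complex"
  assumes pq: "1 \<le> p" "p < q"
    and sfin: "sigma_finite_measure M"
    and std: "\<exists>(f :: 'a \<Rightarrow> 'p::polish_space) B. borel_iso_onto M f B"
    and aut: "\<And>g. nonsing_aut M (\<sigma> g)"
    and omega_meas: "\<And>g. \<omega> g \<in> borel_measurable M"
    and omega_T: "\<And>g. AE x in M. norm (\<omega> g x) = 1"
    and hom_sigma: "\<And>g h. AE x in M. \<sigma> (g + h) x = \<sigma> g (\<sigma> h x)"
    and hom_omega: "\<And>g h. AE x in M.
           \<omega> (g + h) x = \<omega> g x * \<omega> h (inv_into (space M) (\<sigma> g) x)"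
    and cont_sigma: "aut_continuous M \<sigma>"
    and cont_omega: "L0_continuous M \<omega>"
    and Hq: "H1_sharp_vanishes M q \<sigma> \<omega>"
  shows "H1_sharp_vanishes M p \<sigma> \<omega>"
proof -
  interpret twisted_automorphisms M \<sigma> \<omega>
    using aut omega_meas omega_T by unfold_locales
  show ?thesis
    using H1_sharp_vanishes_mono [OF _ _ Hq] pq by simp
qed

end
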